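(* Let $H$ be a subgraph of a connected graph $G=(V,E)$, and let $(H,\vec\phi)$ be a $\mu$-eigencomponent with vertex set $V_H=V_H^o\sqcup V_H^s$ (core $V_H^o$, socket $V_H^s$). Assume that $\vec\phi$ is an eigenvector of the $1$-Laplacian of $H$ with $\vec\phi|_{V_H^s}=0$, and that every vertex $j\notin V_H$ that is adjacent to $V_H$ is not adjacent to any vertex of $V_H^o$. Then the vector $\tilde{\vec\phi}\in\mathbb R^V$ defined by $\tilde\phi_i=\phi_i$ for $i\in V_H$ and $\tilde\phi_i=0$ for $i\notin V_H$ is an eigenvector of the $1$-Laplacian of $G$ with eigenvalue $\mu$.
   Context: All graphs are finite and undirected; $d_i$ is the degree of a vertex (in the graph under consideration). $\mathrm{Sgn}(t)=\{1\}$ if $t>0$, $\{-1\}$ if $t<0$, $[-1,1]$ if $t=0$. A nonzero vector $\vec x$ on the vertices of a graph is an eigenvector of its $1$-Laplacian with eigenvalue $\mu$ if there exist $z_{ij}\in\mathrm{Sgn}(x_i-x_j)$ with $z_{ji}=-z_{ij}$ (for all adjacent $i,j$) such that $\sum_{j\sim i}z_{ij}\in\mu d_i\,\mathrm{Sgn}(x_i)$ for all vertices $i$. A $\mu$-module is a pair $(H,\vec\phi)$ where $H=(V_H,E_H)$ is a connected graph, $\vec\phi\in\mathbb R^{V_H}$ with $\sum_{i}d_i|\phi_i|=1$, $V_H=V_H^o\sqcup V_H^s$ (core and socket; the socket may be empty), no two vertices of $V_H^s$ are adjacent, and there exist $z_{ij}\in\mathrm{Sgn}(\phi_i-\phi_j)$,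 $z_{ji}=-z_{ij}$ (for adjacent $i,j$ in $H$) with $\sum_{j\sim i}z_{ij}\in\mu d_i\,\mathrm{Sgn}(\phi_i)$ for all $i\in V_H^o$ (degrees in $H$). It is a $\mu$-eigencomponent if moreover $V_H^o$ is connected and $\vec\phi=\vec 1_A/\mathrm{vol}(A)$ for some nonempty $A\subset V_H^o$, where $\vec 1_A$ is the indicator vector and $\mathrm{vol}(A)=\sum_{i\in A}d_i$.
   Formalization: It is additionally assumed that every edge of G from a core vertex to a vertex of V_H is an edge of H (automatic if H is an induced subgraph); for arbitrary subgraphs the claim fails, e.g. H the path a-b-c-d, G the 4-cycle, A={a,b}, μ=1/3. *)

theory Defs
  imports Complex_Main "HOL-Library.Indicator_Function" "Graph_Theory.Digraph_Component"
begin

text \<open>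
  Finite simple undirected graphs are rendered by the locale \<open>graph\<close> (finite, symmetric,
  loop-free digraphs without parallel arcs): an undirected edge is a pair of opposite arcs, so the
  degree of a vertex is its \<open>out_degree\<close>.  A vector on the vertices is a function on the
  whole vertex type of which only the values on \<open>verts G\<close> matter.
\<close>

definition Sgn :: "real \<Rightarrow> real set" where
  "Sgn t = (if t > 0 then {1} else if t < 0 then {-1} else {-1..1})"

definition edge_signs ::
    "('a, 'b) pre_digraph \<Rightarrow> ('a \<Rightarrow> real) \<Rightarrow> ('a \<Rightarrow> 'a \<Rightarrow> real) \<Rightarrow> bool" where
  "edge_signs G x z \<longleftrightarrow>
     (\<forall>i j. i \<rightarrow>\<^bsub>G\<^esub> j \<longrightarrow> z i j \<in> Sgn (x i - x j) \<and> z j i = - z i j)"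

definition balanced_at ::
    "('a, 'b) pre_digraph \<Rightarrow> real \<Rightarrow> ('a \<Rightarrow> real) \<Rightarrow> ('a \<Rightarrow> 'a \<Rightarrow> real) \<Rightarrow> 'a \<Rightarrow> bool" where
  "balanced_at G \<mu> x z i \<longleftrightarrow>
     (\<Sum>j\<in>{j. i \<rightarrow>\<^bsub>G\<^esub> j}. z i j) \<in> (\<lambda>s. \<mu> * real (out_degree G i) * s) ` Sgn (x i)"

definition one_laplacian_eigenvector ::
    "('a, 'b) pre_digraph \<Rightarrow> real \<Rightarrow> ('a \<Rightarrow> real) \<Rightarrow> bool" where
  "one_laplacian_eigenvector G \<mu> x \<longleftrightarrow>
     (\<exists>i\<in>verts G. x i \<noteq> 0) \<and>
     (\<exists>z. edge_signs G x z \<and> (\<forall>i\<in>verts G. balanced_at G \<mu> x z i))"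

definition volume :: "('a, 'b) pre_digraph \<Rightarrow> 'a set \<Rightarrow> real" where
  "volume G A = (\<Sum>i\<in>A. real (out_degree G i))"

text \<open>In the next two definitions \<open>C\<close> is the core and \<open>S\<close> the socket.\<close>

definition mu_module ::
    "('a, 'b) pre_digraph \<Rightarrow> 'a set \<Rightarrow> 'a set \<Rightarrow> real \<Rightarrow> ('a \<Rightarrow> real) \<Rightarrow> bool" where
  "mu_module H C S \<mu> \<phi> \<longleftrightarrow>
     graph H \<and> Digraph_Component.connected H \<and>
     (\<Sum>i\<in>verts H. real (out_degree H i) * \<bar>\<phi> i\<bar>) = 1 \<and>
     verts H = C \<union> S \<and> C \<inter> S = {} \<and>
     (\<forall>i\<in>S. \<forall>j\<in>S. \<not> i \<rightarrow>\<^bsub>H\<^esub> j) \<and>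
     (\<exists>z. edge_signs H \<phi> z \<and> (\<forall>i\<in>C. balanced_at H \<mu> \<phi> z i))"

definition mu_eigencomponent ::
    "('a, 'b) pre_digraph \<Rightarrow> 'a set \<Rightarrow> 'a set \<Rightarrow> real \<Rightarrow> ('a \<Rightarrow> real) \<Rightarrow> bool" where
  "mu_eigencomponent H C S \<mu> \<phi> \<longleftrightarrow>
     mu_module H C S \<mu> \<phi> \<and>
     Digraph_Component.connected (H \<restriction> C) \<and>
     (\<exists>A. A \<noteq> {} \<and> A \<subseteq> C \<and> (\<forall>i\<in>verts H. \<phi> i = indicator A i / volume H A))"

end

theory Submission
  imports Defs
begin

text \<open>
  Pairing the eigenvalue equation with the vector itself gives
  \<open>\<mu> * (\<Sum>i. d i * \<bar>\<phi> i\<bar>) = (\<Sum>{i, j}. \<bar>\<phi> i - \<phi> j\<bar>)\<close>, and for this only the equations on the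
  support of \<open>\<phi>\<close> are needed.  As \<open>\<phi>\<close> vanishes on the socket, the module structure and the
  eigenvector structure of \<open>H\<close> therefore share the eigenvalue \<open>\<mu>\<close>.  The signs witnessing the latter
  extend by 0 to \<open>G\<close>: no new edge meets the core, and at all other vertices the vector is 0
  while the degree, hence the set of admissible values, can only grow.
\<close>

lemma (in wf_digraph) neighbours_subset_verts: "{j. i \<rightarrow>\<^bsub>G\<^esub> j} \<subseteq> verts G"
  using adj_in_verts(2) by blast

text \<open>\<open>out_degree\<close> counts arcs while \<open>balanced_at\<close> sums over
  neighbours; without parallel arcs, \<open>head\<close> is injective on the arcs leaving
  \<open>i\<close>, so the two counts agree.\<close>

lemma (in graph) out_degree_eq_card_neighbours: "out_degree G i = card {j. i \<rightarrow>\<^bsub>G\<^esub> j}"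
proof -
  have "inj_on (head G) (out_arcs G i)"
    by (rule inj_onI) (metis arc_to_ends_def in_out_arcs_conv no_multi_arcs)
  moreover have "head G ` out_arcs G i = {j. i \<rightarrow>\<^bsub>G\<^esub> j}"
    by (auto simp: out_arcs_def arcs_ends_conv)
  ultimately show ?thesis
    unfolding out_degree_def by (metis card_image)
qed

lemma Sgn_mult_self: "s \<in> Sgn t \<Longrightarrow> t * s = \<bar>t\<bar>"
  by (auto simp: Sgn_def split: if_splits)

text \<open>Exchanging the two ends of every edge and using the antisymmetry of \<open>z\<close>
  turns \<open>x i * z i j\<close> into \<open>- x j * z i j\<close>. Adding both forms gives
  \<open>(x i - x j) * z i j\<close>, which is the absolute difference. The factor 2 reflects that
  the right side meets each edge once per orientation.\<close>

lemma (in graph) two_sum_mult_signs_eq_variation: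
  assumes z: "edge_signs G x z"
  shows "2 * (\<Sum>i\<in>verts G. x i * (\<Sum>j\<in>{j. i \<rightarrow>\<^bsub>G\<^esub> j}. z i j)) =
         (\<Sum>i\<in>verts G. \<Sum>j\<in>{j. i \<rightarrow>\<^bsub>G\<^esub> j}. \<bar>x i - x j\<bar>)"
proof -
  \<comment> \<open>The neighbourhood is written as a filtered finite set, the shape that
    \<open>sum.swap_restrict\<close> exchanges.\<close>
  let ?N = "\<lambda>i. {j\<in>verts G. i \<rightarrow>\<^bsub>G\<^esub> j}"
  have N: "{j. i \<rightarrow>\<^bsub>G\<^esub> j} = ?N i" for i
    using neighbours_subset_verts by blast
  have sym: "i \<rightarrow>\<^bsub>G\<^esub> j \<longleftrightarrow> j \<rightarrow>\<^bsub>G\<^esub> i" for i j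
    using graph_symmetric by blast
  have "(\<Sum>i\<in>verts G. \<Sum>j\<in>?N i. x i * z i j) = (\<Sum>j\<in>verts G. \<Sum>i\<in>?N j. x i * z i j)"
    by (subst sum.swap_restrict) (auto simp: sym)
  also have "\<dots> = (\<Sum>i\<in>verts G. \<Sum>j\<in>?N i. - x j * z i j)"
    using z by (intro sum.cong refl) (auto simp: edge_signs_def)
  finally have "2 * (\<Sum>i\<in>verts G. \<Sum>j\<in>?N i. x i * z i j) =
      (\<Sum>i\<in>verts G. \<Sum>j\<in>?N i. x i * z i j) + (\<Sum>i\<in>verts G. \<Sum>j\<in>?N i. - x j * z i j)"
    by simp
  also have "\<dots> = (\<Sum>i\<in>verts G. \<Sum>j\<in>?N i. (x i - x j) * z i j)"
    by (simp only: sum.distrib [symmetric]) (simp add: left_diff_distrib)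
  also have "\<dots> = (\<Sum>i\<in>verts G. \<Sum>j\<in>?N i. \<bar>x i - x j\<bar>)"
    using z by (intro sum.cong refl Sgn_mult_self) (auto simp: edge_signs_def)
  finally show ?thesis
    by (simp add: N sum_distrib_left)
qed

text \<open>Multiply the balance relation at \<open>i\<close> by \<open>x i\<close>; where
  \<open>x i = 0\<close> both sides vanish, so balance on the support suffices. The right side
  depends on neither \<open>\<mu>\<close> nor \<open>z\<close>, so the vector determines its
  eigenvalue once the weighted norm is nonzero.\<close>

lemma (in graph) eigenvalue_mult_norm_eq_variation:
  assumes z: "edge_signs G x z"
    and bal: "\<And>i. i \<in> verts G \<Longrightarrow> x i \<noteq> 0 \<Longrightarrow> balanced_at G \<mu> x z i"
  shows "2 * (\<mu> * (\<Sum>i\<in>verts G. real (out_degree G i) * \<bar>x i\<bar>)) =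
         (\<Sum>i\<in>verts G. \<Sum>j\<in>{j. i \<rightarrow>\<^bsub>G\<^esub> j}. \<bar>x i - x j\<bar>)"
proof -
  have "x i * (\<Sum>j\<in>{j. i \<rightarrow>\<^bsub>G\<^esub> j}. z i j) = \<mu> * (real (out_degree G i) * \<bar>x i\<bar>)"
    if "i \<in> verts G" for i
  proof (cases "x i = 0")
    case False
    then obtain s where "s \<in> Sgn (x i)"
      and eq: "(\<Sum>j\<in>{j. i \<rightarrow>\<^bsub>G\<^esub> j}. z i j) = \<mu> * real (out_degree G i) * s"
      using bal[OF \<open>i \<in> verts G\<close> False] by (auto simp: balanced_at_def)
    then have "x i * s = \<bar>x i\<bar>"
      by (simp add: Sgn_mult_self)
    then show ?thesis
      by (simp add: eq mult.left_commute)
  qed simp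
  then have "(\<Sum>i\<in>verts G. x i * (\<Sum>j\<in>{j. i \<rightarrow>\<^bsub>G\<^esub> j}. z i j)) =
      \<mu> * (\<Sum>i\<in>verts G. real (out_degree G i) * \<bar>x i\<bar>)"
    by (subst sum_distrib_left) (rule sum.cong [OF refl])
  then show ?thesis
    using two_sum_mult_signs_eq_variation[OF z] by simp
qed

text \<open>Since \<open>Sgn 0\<close> is \<open>[-1,1]\<close>, the factor \<open>s\<close> for
  \<open>a\<close> can be replaced by \<open>a * s / b\<close> for \<open>b\<close>. If
  \<open>b = 0\<close>, then \<open>a = 0\<close> as well.\<close>

lemma scaled_Sgn_zero_mono:
  assumes "0 \<le> a" "a \<le> b"
  shows "(\<lambda>s. \<mu> * a * s) ` Sgn 0 \<subseteq> (\<lambda>s. \<mu> * b * s) ` Sgn 0"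
proof (cases "b = 0")
  case False
  show ?thesis
  proof
    fix t assume "t \<in> (\<lambda>s. \<mu> * a * s) ` Sgn 0"
    then obtain s where s: "\<bar>s\<bar> \<le> 1" and t: "t = \<mu> * a * s"
      by (auto simp: Sgn_def abs_le_iff)
    have "\<bar>a * s\<bar> \<le> b"
      using assms s mult_left_le[of "\<bar>s\<bar>" a] by (simp add: abs_mult)
    then have "\<bar>a * s / b\<bar> \<le> 1"
      using assms False by simp
    then have "a * s / b \<in> Sgn 0"
      by (simp only: Sgn_def abs_le_iff) auto
    moreover have "t = \<mu> * b * (a * s / b)"
      using False by (simp add: t)
    ultimately show "t \<in> (\<lambda>s. \<mu> * b * s) ` Sgn 0"
      by blast
  qed
qed (use assms in simp)

theorem proposition4:
  fixes G H :: "('a, 'b) pre_digraph"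
    and C S :: "'a set"
    and \<mu> :: real
    and \<phi> :: "'a \<Rightarrow> real"
  assumes "graph G" and "Digraph_Component.connected G"
    and "subgraph H G"
    and "mu_eigencomponent H C S \<mu> \<phi>"
    and core_edges: "\<forall>i\<in>C. \<forall>j\<in>verts H. i \<rightarrow>\<^bsub>G\<^esub> j \<longrightarrow> i \<rightarrow>\<^bsub>H\<^esub> j"
    and "\<exists>\<nu>. one_laplacian_eigenvector H \<nu> \<phi>"
    and "\<forall>i\<in>S. \<phi> i = 0"
    and "\<forall>j\<in>verts G - verts H. (\<exists>i\<in>verts H. j \<rightarrow>\<^bsub>G\<^esub> i) \<longrightarrow> \<not> (\<exists>i\<in>C. j \<rightarrow>\<^bsub>G\<^esub> i)"
  shows "one_laplacian_eigenvector G \<mu> (\<lambda>i. if i \<in> verts H then \<phi> i else 0)"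
proof -
  interpret G: graph G by fact
  have "mu_module H C S \<mu> \<phi>"
    using assms(4) by (simp add: mu_eigencomponent_def)
  then obtain z where "graph H" and verts_H: "verts H = C \<union> S"
    and norm: "(\<Sum>i\<in>verts H. real (out_degree H i) * \<bar>\<phi> i\<bar>) = 1"
    and z: "edge_signs H \<phi> z" "\<forall>i\<in>C. balanced_at H \<mu> \<phi> z i"
    unfolding mu_module_def by blast
  interpret H: graph H by fact
  obtain \<nu> w where nonzero: "\<exists>i\<in>verts H. \<phi> i \<noteq> 0"
    and w: "edge_signs H \<phi> w" "\<forall>i\<in>verts H. balanced_at H \<nu> \<phi> w i"
    using assms(6) by (auto simp: one_laplacian_eigenvector_def)
  \<comment> \<open>Both sides equal the same variation of \<open>\<phi>\<close>, with norm 1. The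
    signs \<open>z\<close> are balanced on \<open>C\<close>, which contains the support of
    \<open>\<phi>\<close>.\<close>
  have "2 * (\<mu> * 1) = 2 * (\<nu> * 1)"
    using H.eigenvalue_mult_norm_eq_variation[OF z(1), of \<mu>]
      H.eigenvalue_mult_norm_eq_variation[OF w(1), of \<nu>] z(2) w(2) verts_H assms(7) norm
    by auto
  then have bal: "\<forall>i\<in>verts H. balanced_at H \<mu> \<phi> w i"
    using w(2) by simp

  define x where "x = (\<lambda>i. if i \<in> verts H then \<phi> i else 0)"
  define u where "u = (\<lambda>i j. if i \<rightarrow>\<^bsub>H\<^esub> j then w i j else 0)"
  have HG: "i \<rightarrow>\<^bsub>H\<^esub> j \<Longrightarrow> i \<rightarrow>\<^bsub>G\<^esub> j" for i j
    using arcs_ends_mono[OF assms(3)] by blast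
  \<comment> \<open>A neighbour outside \<open>H\<close> is excluded by the last hypothesis; one
    inside \<open>H\<close> is reached by an edge of \<open>H\<close> by
    \<open>core_edges\<close>.\<close>
  have core: "i \<rightarrow>\<^bsub>H\<^esub> j" if "i \<in> C" "i \<rightarrow>\<^bsub>G\<^esub> j" for i j
  proof -
    have "j \<in> verts H"
      using that assms(8) verts_H G.graph_symmetric[OF that(2)] G.adj_in_verts(2)[OF that(2)] by blast
    then show ?thesis
      using core_edges that by blast
  qed
  have x_off_core: "x i = 0" if "i \<notin> C" for i
    using that verts_H assms(7) by (auto simp: x_def)
  have finite_nbrs: "finite {j. i \<rightarrow>\<^bsub>G\<^esub> j}" for i
    by (rule finite_subset[OF G.neighbours_subset_verts G.finite_verts])

  have "edge_signs G x u"
    unfolding edge_signs_def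
  proof (intro allI impI)
    fix i j assume G_edge: "i \<rightarrow>\<^bsub>G\<^esub> j"
    show "u i j \<in> Sgn (x i - x j) \<and> u j i = - u i j"
    proof (cases "i \<rightarrow>\<^bsub>H\<^esub> j")
      case True
      then have "i \<in> verts H" "j \<in> verts H"
        by (rule H.adj_in_verts)+
      moreover have "w i j \<in> Sgn (\<phi> i - \<phi> j)" "w j i = - w i j"
        using w(1) True unfolding edge_signs_def by blast+
      ultimately show ?thesis
        using True H.graph_symmetric[OF True] by (simp add: u_def x_def)
    next
      case False
      then have not_symm: "\<not> j \<rightarrow>\<^bsub>H\<^esub> i"
        using H.graph_symmetric[of j i] by blast
      \<comment> \<open>An edge of \<open>G\<close> missing from \<open>H\<close> has both ends
        outside the core, where \<open>x\<close> is 0, so the default sign 0 is admissible.\<close>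
      have "i \<notin> C" "j \<notin> C"
        using core[OF _ G_edge] core[OF _ G.graph_symmetric[OF G_edge]] False not_symm by blast+
      then show ?thesis
        using False not_symm by (simp add: u_def x_off_core Sgn_def)
    qed
  qed
  moreover have "balanced_at G \<mu> x u i" for i
  proof -
    have sum_eq: "(\<Sum>j\<in>{j. i \<rightarrow>\<^bsub>G\<^esub> j}. u i j) = (\<Sum>j\<in>{j. i \<rightarrow>\<^bsub>H\<^esub> j}. w i j)"
      by (rule sum.mono_neutral_cong_right[OF finite_nbrs]) (auto simp: u_def HG)
    have in_H: "(\<Sum>j\<in>{j. i \<rightarrow>\<^bsub>H\<^esub> j}. w i j) \<in>
        (\<lambda>s. \<mu> * real (out_degree H i) * s) ` Sgn (x i)"
    proof (cases "i \<in> verts H")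
      case True
      then show ?thesis
        using bal by (simp add: balanced_at_def x_def)
    next
      \<comment> \<open>Outside \<open>H\<close> the sum is empty, and its value 0 is attained at
        \<open>s = 0\<close>.\<close>
      case False
      then have "{j. i \<rightarrow>\<^bsub>H\<^esub> j} = {}"
        using H.adj_in_verts(1) by blast
      then show ?thesis
        using False by (auto simp: x_def Sgn_def intro!: image_eqI[of _ _ 0])
    qed
    show ?thesis
    proof (cases "i \<in> C")
      case True
      then have "{j. i \<rightarrow>\<^bsub>G\<^esub> j} = {j. i \<rightarrow>\<^bsub>H\<^esub> j}"
        using core HG by blast
      then have "out_degree G i = out_degree H i"
        by (simp add: G.out_degree_eq_card_neighbours H.out_degree_eq_card_neighbours)
      then show ?thesis
        using in_H by (simp add: balanced_at_def sum_eq)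
    next
      case False
      \<comment> \<open>Here \<open>x i = 0\<close>, so the larger degree only widens the interval
        of admissible values.\<close>
      have "out_degree H i \<le> out_degree G i"
        unfolding G.out_degree_eq_card_neighbours H.out_degree_eq_card_neighbours
        using HG by (intro card_mono finite_nbrs) blast
      then show ?thesis
        using in_H scaled_Sgn_zero_mono[of "out_degree H i" "out_degree G i" \<mu>]
        by (auto simp: balanced_at_def sum_eq x_off_core[OF False])
    qed
  qed
  moreover have "\<exists>i\<in>verts G. x i \<noteq> 0"
    using nonzero assms(3) by (auto simp: x_def)
  ultimately show ?thesis
    unfolding one_laplacian_eigenvector_def x_def[symmetric] by blast
qed

end
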